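(* Let $\alpha>0$, let $\nu$ be an angular measure, let $Z\sim\mathcal{MS}(\alpha,\nu)$ with c.d.f. $F_Z$, let $z\in(0,\infty)^d$, and let $g_z$ be the associated Stein solution. We have the following. (1) $g_z$ is constant over $[0,z]$: $$g_z(x)=-F_Z(z)\int_0^\infty\big(F_Z(z)^{-e^{-t}}-1\big)\mathrm dt,\qquad x\in[0,z].$$ Furthermore, for every $j\in\{1,\dots,d\}$, $g_z(x)\sim\alpha F_Z(z)\log x^j$ as $x^j\to+\infty$. (2) Assume there is only one $j_0\in\{1,\dots,d\}$ such that $$\frac{x^{j_0}}{z^{j_0}}\ge\frac{x^j}{z^j}\qquad\text{for all }j\in\{1,\dots,d\}.$$ Then $g_z$ is continuously differentiable over $\mathbb{R}_+^d$ and one has $$\partial_jg_z(x)=\begin{cases}\dfrac{\alpha}{x^j}\,F_Z(z)^{1-(z^j/x^j)^\alpha}&\text{if }j=j_0,\\[1ex]0&\text{otherwise.}\end{cases}$$ (3) $\partial_jg_z$ satisfies the inequality $$|\partial_jg_z(x)|\le\frac{\alpha}{x^j}\mathbf 1_{\{x^j>z^j\}},\qquad j\in\{1,\dots,d\}.$$ Thus $g_z$ also satisfies, for all $x,y\in\mathbb{R}_+^d$, $$\alpha^{-1}|g_z(x)-g_z(y)|\le\min\Big(\big\|\log(x\oplus z)-\log(y\oplus z)\big\|_1,\ \frac1{z^*}\big\|x\oplus z-y\oplus z\big\|_1\Big),$$ where $z^*$ is the smallest non-null coordinate of $z$. In particular, $g_z$ is $\alpha/z^*$-Lipschitz.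
   Context: Fix $d\ge 1$, $\mathbb{R}_+=[0,\infty)$. Operations on vectors (powers, logarithms, quotients, inequalities) are coordinate-wise; $x\oplus y$ is the coordinate-wise maximum; $\|x\|_1=\sum_j|x^j|$; Lipschitz constants are with respect to $\|\cdot\|_1$. Let $E_0=[0,\infty)^d\setminus\{0\}$, $[0,x]=\prod_j[0,x^j]$ and (for exponent measures) $[0,x]^c$ its complement in $E_0$. Fix a norm $\|\cdot\|$ on $\mathbb{R}^d$ such that $\mathbf{S}_+^{d-1}=\{x\in\mathbb{R}_+^d:\|x\|=1\}\subseteq[0,1]^d$. An angular measure is a finite Borel measure $\nu$ on $\mathbf{S}_+^{d-1}$ with $\int u^j\,\mathrm d\nu(u)=1$ for $j=1,\dots,d$. For $\alpha>0$ the exponent measure $\mu$ is the pushforward of $\alpha r^{-\alpha-1}\mathrm dr\otimes\nu(\mathrm du)$ on $(0,\infty)\times\mathbf{S}_+^{d-1}$ by $(r,u)\mapsto r\,u^{1/\alpha}$. $\mathcal{MS}(\alpha,\nu)$ is the law of the max-stable random vector $Z$ on $(0,\infty)^d$ with $F_Z(z)=\mathbb{P}(Z\le z)=e^{-\mu([0,z]^c)}$, $z\in(0,\infty)^d$. The semi-group is $\mathbf{P}_t h(x)=\mathbb{E}\big[h\big(e^{-t/\alpha}x\oplus(1-e^{-t})^{1/\alpha}Z\big)\big]$, $t\ge0$. The Stein solution for $h_z=\mathbf 1_{[0,z]}$ is $g_z(x)=-\int_0^\infty\big(\mathbf{P}_t h_z(x)-F_Z(z)\big)\mathrm dt$, $x\in\mathbb{R}_+^d$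 (a convergent integral).
   Formalization: Part (2) as printed fails on [0,z]: there g_z is constant, and it has a kink where x^{j0}=z^{j0}. Proved: g_z is C^1 on points of R_+^d with a unique j0 and x^{j0}≠z^{j0}; the printed formula holds if x^{j0}>z^{j0}, and all partial derivatives are 0 if x^{j0}<z^{j0}. *)

theory Defs
  imports "HOL-Probability.Probability"
begin

text \<open>
  Vectors of dimension \<open>d \<ge> 1\<close> are elements of \<open>real ^ 'd\<close>. The library orders them coordinate-wise,
  so \<open>sup\<close> is the coordinate-wise maximum and \<open>{0..x}\<close> is the box \<open>[0,x]\<close>.
  The library's strict order \<open><\<close> on vectors is not coordinate-wise and is avoided.
\<close>

definition orthant :: "(real ^ 'd) set" where
  "orthant = {x. \<forall>j. 0 \<le> x $ j}"

definition pos_vec :: "real ^ 'd \<Rightarrow> bool" where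
  "pos_vec x \<longleftrightarrow> (\<forall>j. 0 < x $ j)"

definition norm1 :: "real ^ 'd \<Rightarrow> real" where
  "norm1 x = (\<Sum>j\<in>UNIV. \<bar>x $ j\<bar>)"

definition ln_vec :: "real ^ 'd \<Rightarrow> real ^ 'd" where
  "ln_vec x = (\<chi> j. ln (x $ j))"

definition powr_vec :: "real ^ 'd \<Rightarrow> real \<Rightarrow> real ^ 'd" where
  "powr_vec x a = (\<chi> j. (x $ j) powr a)"

definition is_norm :: "(real ^ 'd \<Rightarrow> real) \<Rightarrow> bool" where
  "is_norm N \<longleftrightarrow> (\<forall>x. 0 \<le> N x) \<and> (\<forall>x. N x = 0 \<longleftrightarrow> x = 0) \<and>
     (\<forall>c x. N (c *\<^sub>R x) = \<bar>c\<bar> * N x) \<and> (\<forall>x y. N (x + y) \<le> N x + N y)"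

definition pos_sphere :: "(real ^ 'd \<Rightarrow> real) \<Rightarrow> (real ^ 'd) set" where
  "pos_sphere N = {x \<in> orthant. N x = 1}"

definition angular_measure :: "(real ^ 'd \<Rightarrow> real) \<Rightarrow> (real ^ 'd) measure \<Rightarrow> bool" where
  "angular_measure N \<nu> \<longleftrightarrow>
     sets \<nu> = sets (restrict_space borel (pos_sphere N)) \<and> finite_measure \<nu> \<and>
     (\<forall>j. (\<integral>u. u $ j \<partial>\<nu>) = 1)"

definition E0 :: "(real ^ 'd) set" where
  "E0 = orthant - {0}"

definition radial_measure :: "real \<Rightarrow> real measure" where
  "radial_measure \<alpha> =
     density (restrict_space lborel {0<..}) (\<lambda>r. ennreal (\<alpha> * r powr (- \<alpha> - 1)))"

definition exponent_measure :: "real \<Rightarrow> (real ^ 'd) measure \<Rightarrow> (real ^ 'd) measure" where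
  "exponent_measure \<alpha> \<nu> =
     distr (radial_measure \<alpha> \<Otimes>\<^sub>M \<nu>) (restrict_space borel E0)
       (\<lambda>(r, u). r *\<^sub>R powr_vec u (1 / \<alpha>))"

text \<open>
  For \<open>z\<close> with positive coordinates the complement of \<open>[0,z]\<close> has finite exponent measure, so the
  real-valued \<open>measure\<close> below agrees with the extended-real one.
\<close>

definition max_stable_law ::
    "real \<Rightarrow> (real ^ 'd) measure \<Rightarrow> (real ^ 'd) measure \<Rightarrow> bool" where
  "max_stable_law \<alpha> \<nu> L \<longleftrightarrow>
     prob_space L \<and> sets L = sets borel \<and> (AE x in L. pos_vec x) \<and>
     (\<forall>z. pos_vec z \<longrightarrow>
        measure L {x. x \<le> z} = exp (- measure (exponent_measure \<alpha> \<nu>) (E0 - {0..z})))"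

definition joint_cdf :: "'w measure \<Rightarrow> ('w \<Rightarrow> real ^ 'd) \<Rightarrow> real ^ 'd \<Rightarrow> real" where
  "joint_cdf M Z z = measure M {\<omega> \<in> space M. Z \<omega> \<le> z}"

definition stein_semigroup ::
    "'w measure \<Rightarrow> ('w \<Rightarrow> real ^ 'd) \<Rightarrow> real \<Rightarrow> real \<Rightarrow> (real ^ 'd \<Rightarrow> real) \<Rightarrow> real ^ 'd \<Rightarrow> real"
  where
  "stein_semigroup M Z \<alpha> t h x =
     (\<integral>\<omega>. h (sup (exp (- t / \<alpha>) *\<^sub>R x) ((1 - exp (- t)) powr (1 / \<alpha>) *\<^sub>R Z \<omega>)) \<partial>M)"

definition stein_solution ::
    "'w measure \<Rightarrow> ('w \<Rightarrow> real ^ 'd) \<Rightarrow> real \<Rightarrow> real ^ 'd \<Rightarrow> real ^ 'd \<Rightarrow> real" where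
  "stein_solution M Z \<alpha> z x =
     - (LINT t:{0..}|lborel. stein_semigroup M Z \<alpha> t (indicator {0..z}) x - joint_cdf M Z z)"

definition coord_upd :: "real ^ 'd \<Rightarrow> 'd \<Rightarrow> real \<Rightarrow> real ^ 'd" where
  "coord_upd x j s = (\<chi> k. if k = j then s else x $ k)"

text \<open>
  Derivatives of functions on the orthant are taken relative to the orthant, hence one-sided
  at points having vanishing coordinates.
\<close>

definition has_partial_derivative ::
    "(real ^ 'd \<Rightarrow> real) \<Rightarrow> 'd \<Rightarrow> real ^ 'd \<Rightarrow> real \<Rightarrow> bool" where
  "has_partial_derivative f j x D \<longleftrightarrow>
     ((\<lambda>s. f (coord_upd x j s)) has_real_derivative D) (at (x $ j) within {0..})"

definition continuously_differentiable_on ::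
    "(real ^ 'd \<Rightarrow> real) \<Rightarrow> (real ^ 'd) set \<Rightarrow> bool" where
  "continuously_differentiable_on f U \<longleftrightarrow>
     (\<exists>f' :: real ^ 'd \<Rightarrow> (real ^ 'd) \<Rightarrow>\<^sub>L real.
        (\<forall>x\<in>U. (f has_derivative blinfun_apply (f' x)) (at x within orthant)) \<and>
        continuous_on U f')"

definition lipschitz1_on :: "real \<Rightarrow> (real ^ 'd) set \<Rightarrow> (real ^ 'd \<Rightarrow> real) \<Rightarrow> bool" where
  "lipschitz1_on L S f \<longleftrightarrow> 0 \<le> L \<and> (\<forall>x\<in>S. \<forall>y\<in>S. \<bar>f x - f y\<bar> \<le> L * norm1 (x - y))"

definition min_nonnull :: "real ^ 'd \<Rightarrow> real" where
  "min_nonnull z = Min ((\<lambda>j. z $ j) ` {j. z $ j \<noteq> 0})"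

definition unique_dominant :: "real ^ 'd \<Rightarrow> real ^ 'd \<Rightarrow> 'd \<Rightarrow> bool" where
  "unique_dominant z x j0 \<longleftrightarrow>
     (\<forall>i. (\<forall>j. x $ j / z $ j \<le> x $ i / z $ i) \<longleftrightarrow> i = j0)"

text \<open>
  The points with a unique dominant coordinate at which the Stein solution is smooth. Points with
  \<open>x $ j0 = z $ j0\<close> lie on the relative boundary of \<open>[0,z]\<close>, where the \<open>j0\<close>-th partial derivative
  jumps from \<open>0\<close> to \<open>\<alpha> / z $ j0\<close>.
\<close>

definition smooth_region :: "real ^ 'd \<Rightarrow> (real ^ 'd) set" where
  "smooth_region z = {x \<in> orthant. \<exists>j0. unique_dominant z x j0 \<and> x $ j0 \<noteq> z $ j0}"

end

theory Submission
  imports Defs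
begin

text \<open>
  The exponent measure is homogeneous of order \<open>- \<alpha>\<close>, so \<open>P(s *\<^sub>R Z \<le> z) = F powr (1 - exp (- t))\<close> for
  \<open>s = (1 - exp (- t)) powr (1 / \<alpha>)\<close>. Hence the semigroup applied to the indicator of \<open>[0,z]\<close> vanishes
  up to the time \<open>\<tau> x = \<alpha> * max\<^sub>j ln (max (x $ j) (z $ j) / z $ j)\<close> at which \<open>exp (- t / \<alpha>) *\<^sub>R x\<close>
  enters the box, and equals \<open>F powr (1 - exp (- t))\<close> afterwards. The Stein solution is therefore \<open>G (\<tau> x)\<close>
  for a function \<open>G\<close> of one variable with \<open>G' t = F powr (1 - exp (- t)) \<in> [F, 1]\<close>, and every
  claim reduces to elementary facts about \<open>G\<close> and \<open>\<tau>\<close>.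
\<close>

subsection \<open>Homogeneity of the exponent measure\<close>

text \<open>The radial factor is all of \<open>borel\<close>, not only the half-line: the scaling
  argument needs the slices to be measurable in \<open>r\<close> on the whole line. Measurability is
  checked coordinate by coordinate.\<close>

lemma measurable_scaleR_powr_vec:
  assumes "sets \<nu> = sets (restrict_space borel S)"
  shows "(\<lambda>(r, u). r *\<^sub>R powr_vec u a) \<in> borel \<Otimes>\<^sub>M \<nu> \<rightarrow>\<^sub>M (borel :: (real ^ 'd) measure)"
proof -
  have [measurable]: "(\<lambda>u. u) \<in> \<nu> \<rightarrow>\<^sub>M (borel :: (real ^ 'd) measure)"
    by (subst measurable_cong_sets[OF assms refl]) (simp add: measurable_restrict_space1)
  have nth [measurable]: "(\<lambda>u :: real ^ 'd. u $ j) \<in> borel_measurable borel" for j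
    by (intro borel_measurable_continuous_onI continuous_intros)
  have "(\<lambda>p. fst p * (snd p $ j) powr a) \<in> borel_measurable (borel \<Otimes>\<^sub>M \<nu>)" for j
    by measurable
  then show ?thesis
    by (subst borel_measurable_euclidean_space)
      (auto simp: Basis_vec_def cart_eq_inner_axis[symmetric] powr_vec_def case_prod_beta)
qed

lemma sets_radial_measure [measurable_cong]: "sets (radial_measure \<alpha>) = sets (restrict_space borel {0<..})"
  by (simp add: radial_measure_def sets_restrict_space)

lemma space_radial_measure: "space (radial_measure \<alpha>) = {0<..}"
  by (simp add: radial_measure_def space_restrict_space)

text \<open>Tonelli for the product measure behind the pushforward, sliced at fixed radius
  \<open>r\<close>. The image of a sphere point under a positive radius always lies in
  \<open>E0\<close>, so membership in the box reduces to the upper constraint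
  \<open>\<le> z\<close>.\<close>

lemma emeasure_exponent_measure:
  assumes \<nu>: "angular_measure N \<nu>" and N: "is_norm N"
  shows "emeasure (exponent_measure \<alpha> \<nu>) (E0 - {0..z}) =
    (\<integral>\<^sup>+r. emeasure \<nu> {u \<in> space \<nu>. \<not> r *\<^sub>R powr_vec u (1 / \<alpha>) \<le> z} \<partial>radial_measure \<alpha>)"
proof -
  let ?f = "\<lambda>(r, u :: real ^ 'd). r *\<^sub>R powr_vec u (1 / \<alpha>)"
  let ?P = "radial_measure \<alpha> \<Otimes>\<^sub>M \<nu>"
  have sets_\<nu>: "sets \<nu> = sets (restrict_space borel (pos_sphere N))"
    and fin: "finite_measure \<nu>"
    using \<nu> by (auto simp: angular_measure_def)
  interpret finite_measure \<nu> by fact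
  have space_\<nu>: "space \<nu> = pos_sphere N"
    using sets_eq_imp_space_eq[OF sets_\<nu>] by (simp add: space_restrict_space)
  \<comment> \<open>The norm vanishes at the origin, so every point of the sphere has a nonzero
    coordinate; this is why positive radii map the sphere into \<open>E0\<close>.\<close>
  have "0 \<notin> pos_sphere N"
    using N unfolding is_norm_def pos_sphere_def by (metis (mono_tags, lifting) mem_Collect_eq zero_neq_one)
  then have nz: "u \<noteq> 0" if "u \<in> pos_sphere N" for u
    using that by auto
  have E0: "r *\<^sub>R powr_vec u (1 / \<alpha>) \<in> E0" if r: "r > 0" and u: "u \<in> pos_sphere N" for r u
  proof -
    obtain j where "u $ j \<noteq> 0"
      using nz[OF u] by (auto simp: vec_eq_iff)
    then have "(r *\<^sub>R powr_vec u (1 / \<alpha>)) $ j \<noteq> 0"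
      using \<open>r > 0\<close> by (simp add: powr_vec_def)
    then have "r *\<^sub>R powr_vec u (1 / \<alpha>) \<noteq> 0"
      by (metis zero_index)
    then show ?thesis
      using \<open>r > 0\<close> by (simp add: E0_def orthant_def powr_vec_def)
  qed
  have f_borel: "?f \<in> ?P \<rightarrow>\<^sub>M borel"
  proof -
    have "(\<lambda>p. ?f (fst p, snd p)) \<in> ?P \<rightarrow>\<^sub>M borel"
    proof (rule measurable_compose[OF _ measurable_scaleR_powr_vec[OF sets_\<nu>]])
      show "(\<lambda>p. (fst p, snd p)) \<in> ?P \<rightarrow>\<^sub>M borel \<Otimes>\<^sub>M \<nu>"
        by (intro measurable_Pair measurable_snd measurable_compose[OF measurable_fst])
          (simp add: measurable_cong_sets[OF sets_radial_measure refl] measurable_restrict_space1)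
    qed
    then show ?thesis by simp
  qed
  have f: "?f \<in> ?P \<rightarrow>\<^sub>M restrict_space borel E0"
    using f_borel E0 by (intro measurable_restrict_space2)
      (auto simp: space_pair_measure space_radial_measure space_\<nu>)
  have set: "E0 - {0..z} \<in> sets (restrict_space borel E0)"
    unfolding sets_restrict_space by (rule image_eqI[where x = "- {0..z}"]) auto
  have "emeasure (exponent_measure \<alpha> \<nu>) (E0 - {0..z}) = emeasure ?P (?f -` (E0 - {0..z}) \<inter> space ?P)"
    unfolding exponent_measure_def by (intro emeasure_distr f set)
  also have "\<dots> = (\<integral>\<^sup>+r. emeasure \<nu> (Pair r -` (?f -` (E0 - {0..z}) \<inter> space ?P)) \<partial>radial_measure \<alpha>)"
    by (intro emeasure_pair_measure_alt measurable_sets[OF f set])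
  also have "\<dots> = (\<integral>\<^sup>+r. emeasure \<nu> {u \<in> space \<nu>. \<not> r *\<^sub>R powr_vec u (1 / \<alpha>) \<le> z} \<partial>radial_measure \<alpha>)"
  proof (intro nn_integral_cong arg_cong[of _ _ "emeasure \<nu>"])
    fix r assume "r \<in> space (radial_measure \<alpha>)"
    then have "r > 0" by (simp add: space_radial_measure)
    have "0 \<le> x" if "x \<in> E0" for x :: "real ^ 'd"
      using that by (simp add: E0_def orthant_def less_eq_vec_def)
    then have "r *\<^sub>R powr_vec u (1 / \<alpha>) \<in> E0 - {0..z} \<longleftrightarrow> \<not> r *\<^sub>R powr_vec u (1 / \<alpha>) \<le> z"
      if "u \<in> pos_sphere N" for u
      using E0[OF \<open>r > 0\<close> that] by auto
    then show "Pair r -` (?f -` (E0 - {0..z}) \<inter> space ?P) =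
        {u \<in> space \<nu>. \<not> r *\<^sub>R powr_vec u (1 / \<alpha>) \<le> z}"
      using \<open>r > 0\<close> by (auto simp: space_pair_measure space_radial_measure space_\<nu> simp del: Diff_iff)
  qed
  finally show ?thesis .
qed

text \<open>Substitution of \<open>c * r\<close> for \<open>r\<close>: the density is homogeneous of
  degree \<open>- \<alpha> - 1\<close> and the Jacobian contributes a factor \<open>c\<close>, which
  leaves \<open>c powr (- \<alpha>)\<close>.\<close>

lemma nn_integral_radial_measure_scale:
  assumes [measurable]: "f \<in> borel_measurable borel" and c: "c > 0"
  shows "(\<integral>\<^sup>+r. f (r / c) \<partial>radial_measure \<alpha>) = ennreal (c powr (- \<alpha>)) * (\<integral>\<^sup>+r. f r \<partial>radial_measure \<alpha>)"
proof -
  let ?d = "\<lambda>r. ennreal (\<alpha> * r powr (- \<alpha> - 1)) * indicator {0<..} r"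
  \<comment> \<open>The half-line is absorbed into the indicator in \<open>?d\<close>, so that the
    affine substitution for \<open>lborel\<close> on the whole line applies.\<close>
  have radial: "(\<integral>\<^sup>+r. h r \<partial>radial_measure \<alpha>) = (\<integral>\<^sup>+r. ?d r * h r \<partial>lborel)"
    if [measurable]: "h \<in> borel_measurable borel" for h
  proof -
    have "h \<in> borel_measurable (restrict_space lborel {0<..})"
      by (simp add: measurable_restrict_space1)
    moreover have "(\<lambda>r. ennreal (\<alpha> * r powr (- \<alpha> - 1))) \<in> borel_measurable (restrict_space lborel {0<..})"
      by (intro measurable_restrict_space1) measurable
    ultimately show ?thesis
      unfolding radial_measure_def
      by (subst nn_integral_density) (auto simp: nn_integral_restrict_space mult_ac)
  qed
  have "(\<integral>\<^sup>+r. f (r / c) \<partial>radial_measure \<alpha>) = (\<integral>\<^sup>+r. ?d r * f (r / c) \<partial>lborel)"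
    by (rule radial) measurable
  also have "\<dots> = ennreal c * (\<integral>\<^sup>+r. ?d (c * r) * f r \<partial>lborel)"
    using c by (subst nn_integral_real_affine[where c = c and t = 0]) (auto simp: abs_of_pos)
  also have "\<dots> = (\<integral>\<^sup>+r. ennreal (c powr (- \<alpha>)) * (?d r * f r) \<partial>lborel)"
  proof (subst nn_integral_cmult[symmetric], measurable, intro nn_integral_cong)
    fix r :: real
    have "ennreal c * ?d (c * r) = ennreal (c powr (- \<alpha>)) * ?d r"
    proof (cases "r > 0")
      case True
      have "c * (\<alpha> * (c * r) powr (- \<alpha> - 1)) = c powr (- \<alpha>) * (\<alpha> * r powr (- \<alpha> - 1))"
        using c True by (simp add: powr_mult powr_diff field_simps)
      then have "ennreal (c * (\<alpha> * (c * r) powr (- \<alpha> - 1))) =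
          ennreal (c powr (- \<alpha>) * (\<alpha> * r powr (- \<alpha> - 1)))"
        by (rule arg_cong)
      then have "ennreal c * ennreal (\<alpha> * (c * r) powr (- \<alpha> - 1)) =
          ennreal (c powr (- \<alpha>)) * ennreal (\<alpha> * r powr (- \<alpha> - 1))"
        by (simp only: ennreal_mult'[OF less_imp_le[OF c]] ennreal_mult'[OF powr_ge_zero])
      then show ?thesis
        using c True by simp
    qed (use c in \<open>auto simp: zero_less_mult_iff\<close>)
    then show "ennreal c * (?d (c * r) * f r) = ennreal (c powr (- \<alpha>)) * (?d r * f r)"
      by (metis mult.assoc)
  qed
  also have "\<dots> = ennreal (c powr (- \<alpha>)) * (\<integral>\<^sup>+r. ?d r * f r \<partial>lborel)"
    by (rule nn_integral_cmult) measurable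
  also have "(\<integral>\<^sup>+r. ?d r * f r \<partial>lborel) = (\<integral>\<^sup>+r. f r \<partial>radial_measure \<alpha>)"
    by (rule radial[symmetric]) measurable
  finally show ?thesis .
qed

text \<open>Enlarging the box by \<open>c\<close> changes a slice exactly as dividing the radius by
  \<open>c\<close> does, so the radial scaling rule applies to the slice masses. This is the source
  of max-stability: it turns a rescaling of \<open>z\<close> into a power of the c.d.f.\<close>

lemma measure_exponent_measure_scale:
  fixes z :: "real ^ 'd"
  assumes \<nu>: "angular_measure N \<nu>" and N: "is_norm N" and c: "c > 0"
  shows "measure (exponent_measure \<alpha> \<nu>) (E0 - {0..c *\<^sub>R z}) =
    c powr (- \<alpha>) * measure (exponent_measure \<alpha> \<nu>) (E0 - {0..z})"
proof -
  let ?A = "\<lambda>z r. {u \<in> space \<nu>. \<not> r *\<^sub>R powr_vec u (1 / \<alpha>) \<le> z}"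
  have sets_\<nu>: "sets \<nu> = sets (restrict_space borel (pos_sphere N))"
    and fin: "finite_measure \<nu>"
    using \<nu> by (auto simp: angular_measure_def)
  interpret finite_measure \<nu> by fact
  note [measurable] = measurable_scaleR_powr_vec[OF sets_\<nu>]
  have "(\<lambda>(r, u). r *\<^sub>R powr_vec u (1 / \<alpha>)) -` (- {..z}) \<inter> space (borel \<Otimes>\<^sub>M \<nu>) \<in> sets (borel \<Otimes>\<^sub>M \<nu>)"
    by measurable
  from measurable_emeasure_Pair[OF this]
  have meas: "(\<lambda>r. emeasure \<nu> (?A z r)) \<in> borel_measurable borel"
    by (rule measurable_cong[THEN iffD1, rotated]) (auto intro!: arg_cong[of _ _ "emeasure \<nu>"] simp: space_pair_measure)
  have "?A (c *\<^sub>R z) r = ?A z (r / c)" for r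
    using c by (auto simp: less_eq_vec_def field_simps)
  then have "emeasure (exponent_measure \<alpha> \<nu>) (E0 - {0..c *\<^sub>R z}) =
      ennreal (c powr (- \<alpha>)) * emeasure (exponent_measure \<alpha> \<nu>) (E0 - {0..z})"
    using nn_integral_radial_measure_scale[OF meas c]
    by (simp add: emeasure_exponent_measure[OF \<nu> N])
  \<comment> \<open>\<open>enn2real\<close> is multiplicative on all of \<open>ennreal\<close>,
    infinity being sent to \<open>0\<close>, so the identity passes to
    \<open>measure\<close>.\<close>
  then show ?thesis
    by (simp add: measure_def enn2real_mult)
qed

subsection \<open>The Stein solution as a function of one variable\<close>

text \<open>Factoring \<open>F\<close> as \<open>F powr (1 - exp (- t)) * F powr exp (- t)\<close>
  writes the gap as a product of two factors in the unit interval. The exponential decay comes from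
  \<open>1 + y \<le> exp y\<close> at \<open>y = exp (- t) * ln F\<close>.\<close>

lemma powr_gap_bounds:
  fixes F :: real
  assumes F: "0 < F" "F \<le> 1" and t: "t \<ge> 0"
  shows "0 \<le> F powr (1 - exp (- t)) - F" "F powr (1 - exp (- t)) - F \<le> - ln F * exp (- t)"
    "F powr (1 - exp (- t)) \<le> 1"
proof -
  let ?a = "F powr (1 - exp (- t))"
  have lnF: "ln F \<le> 0" using F by simp
  have "0 < ?a" using F by simp
  show le1: "?a \<le> 1" using F t by (simp add: powr_le1)
  have "F = ?a * F powr exp (- t)"
    using F by (simp flip: powr_add)
  moreover have "F powr exp (- t) \<le> 1" using F by (simp add: powr_le1)
  moreover have "1 - F powr exp (- t) \<le> - ln F * exp (- t)"
    using exp_ge_add_one_self[of "exp (- t) * ln F"] F by (simp add: powr_def mult_ac del: exp_ge_add_one_self)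
  ultimately have "?a - F = ?a * (1 - F powr exp (- t))" "0 \<le> 1 - F powr exp (- t)"
    by (auto simp: algebra_simps)
  moreover have "?a * (1 - F powr exp (- t)) \<le> 1 - F powr exp (- t)"
    using le1 calculation(2) by (intro mult_left_le_one_le) (use \<open>0 < ?a\<close> in auto)
  ultimately show "0 \<le> ?a - F" "?a - F \<le> - ln F * exp (- t)"
    using \<open>0 < ?a\<close> \<open>1 - F powr exp (- t) \<le> - ln F * exp (- t)\<close> by auto
qed

text \<open>The exponential bound on the gap dominates over the open half-line; the endpoint
  \<open>0\<close> is then added as a degenerate interval, where continuity suffices.\<close>

lemma set_integrable_powr_gap:
  fixes F :: real
  assumes F: "0 < F" "F \<le> 1"
  shows "set_integrable lborel {0..} (\<lambda>t. F powr (1 - exp (- t)) - F)"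
proof -
  have "set_integrable lborel {0<..} (\<lambda>t. F powr (1 - exp (- t)) - F)"
  proof (rule set_integrable_bound)
    show "set_integrable lborel {0<..} (\<lambda>t. - ln F * exp (- t))"
      using integrable_I0i_exp_mscale[of 1] by (intro set_integrable_mult_right) simp
    show "set_borel_measurable lborel {0<..} (\<lambda>t. F powr (1 - exp (- t)) - F)"
      unfolding set_borel_measurable_def by measurable
    show "AE t in lborel. t \<in> {0<..} \<longrightarrow>
        norm (F powr (1 - exp (- t)) - F) \<le> norm (- ln F * exp (- t))"
      using powr_gap_bounds[OF F] by (intro AE_I2) (auto intro: order_trans[OF _ abs_ge_minus_self])
  qed
  moreover have "set_integrable lborel {0} (\<lambda>t. F powr (1 - exp (- t)) - F)"
    by (rule set_integrable_subset[OF borel_integrable_atLeastAtMost'[of 0 0]]) auto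
  ultimately have "set_integrable lborel ({0<..} \<union> {0}) (\<lambda>t. F powr (1 - exp (- t)) - F)"
    by (rule set_integrable_Un) auto
  moreover have "{0<..} \<union> {0} = {0 :: real..}" by auto
  ultimately show ?thesis by simp
qed

text \<open>The value of the Stein solution at a point that enters the box at time
  \<open>\<tau>\<close>. The improper integral is split off as a constant, so that
  \<open>\<tau>\<close> occurs only as the endpoint of a proper integral and can be
  differentiated.\<close>

definition stein_profile :: "real \<Rightarrow> real \<Rightarrow> real" where
  "stein_profile F \<tau> =
     integral {0..\<tau>} (\<lambda>t. F powr (1 - exp (- t))) - (LINT t:{0..}|lborel. F powr (1 - exp (- t)) - F)"

context
  fixes F :: real
  assumes F: "0 < F" "F \<le> 1"
begin

lemma stein_profile_eq:
  assumes "\<tau> \<ge> 0"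
  shows "stein_profile F \<tau> =
    - (LINT t:{0..}|lborel. (if \<tau> \<le> t then F powr (1 - exp (- t)) else 0) - F)"
proof -
  let ?e = "\<lambda>t. F powr (1 - exp (- t))"
  have "continuous_on {0..\<tau>} ?e"
    using F by (intro continuous_intros) auto
  then have e: "set_integrable lborel {0..\<tau>} ?e"
    by (rule borel_integrable_atLeastAtMost')
  have "(LINT t:{0..}|lborel. (if \<tau> \<le> t then ?e t else 0) - F) =
      (\<integral>t. indicator {0..} t *\<^sub>R (?e t - F) - indicator {0..\<tau>} t *\<^sub>R ?e t \<partial>lborel)"
    unfolding set_lebesgue_integral_def
  proof (rule integral_cong_AE)
    \<comment> \<open>The two integrands disagree at the single point \<open>t = \<tau>\<close>,
      where the closed interval \<open>{0..\<tau>}\<close> also removes the power of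
      \<open>F\<close>.\<close>
    show "AE t in lborel. indicator {0..} t *\<^sub>R ((if \<tau> \<le> t then ?e t else 0) - F) =
        indicator {0..} t *\<^sub>R (?e t - F) - indicator {0..\<tau>} t *\<^sub>R ?e t"
      using AE_lborel_singleton[of \<tau>] by eventually_elim (auto simp: indicator_def)
  qed measurable
  also have "\<dots> = (LINT t:{0..}|lborel. ?e t - F) - (LINT t:{0..\<tau>}|lborel. ?e t)"
    using set_integrable_powr_gap[OF F] e
    unfolding set_lebesgue_integral_def set_integrable_def by (rule Bochner_Integration.integral_diff)
  also have "(LINT t:{0..\<tau>}|lborel. ?e t) = integral {0..\<tau>} ?e"
    by (rule set_borel_integral_eq_integral(2)[OF e])
  finally show ?thesis by (simp add: stein_profile_def)
qed

lemma stein_profile_0: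
  "stein_profile F 0 = - F * (LINT t:{0..}|lborel. F powr (- exp (- t)) - 1)"
proof -
  have "F powr (1 - exp (- t)) - F = F * (F powr (- exp (- t)) - 1)" for t
    using F by (simp add: powr_diff powr_minus field_simps)
  then show ?thesis
    by (simp add: stein_profile_def)
qed

text \<open>Fundamental theorem of calculus. Working relative to \<open>{0..b}\<close> includes the
  one-sided derivative at \<open>0\<close>, which the Lipschitz bound on the closed half-line
  uses.\<close>

lemma has_real_derivative_stein_profile_within:
  assumes "t \<in> {0..b}"
  shows "(stein_profile F has_real_derivative F powr (1 - exp (- t))) (at t within {0..b})"
proof -
  have "continuous_on {0..b} (\<lambda>t. F powr (1 - exp (- t)))"
    using F by (intro continuous_intros) auto
  from integral_has_real_derivative[OF this assms]
  show ?thesis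
    unfolding stein_profile_def by (auto intro!: derivative_eq_intros)
qed

lemma has_real_derivative_stein_profile:
  assumes "t > 0"
  shows "(stein_profile F has_real_derivative F powr (1 - exp (- t))) (at t)"
proof -
  have "at t within {0..t + 1} = at t"
    using assms by (intro at_within_interior) auto
  then show ?thesis
    using has_real_derivative_stein_profile_within[of t "t + 1"] assms by simp
qed

text \<open>The slope is a power of \<open>F \<le> 1\<close> with nonnegative exponent, hence at
  most \<open>1\<close>, and the mean value bound applies.\<close>

lemma stein_profile_lipschitz:
  assumes "a \<ge> 0" "b \<ge> 0"
  shows "\<bar>stein_profile F a - stein_profile F b\<bar> \<le> \<bar>a - b\<bar>"
proof -
  have "norm (stein_profile F a - stein_profile F b) \<le> 1 * norm (a - b)"
  proof (rule field_differentiable_bound)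
    show "(stein_profile F has_field_derivative F powr (1 - exp (- t))) (at t within {0..max a b})"
      if "t \<in> {0..max a b}" for t
      using has_real_derivative_stein_profile_within[OF that] .
    show "norm (F powr (1 - exp (- t))) \<le> 1" if "t \<in> {0..max a b}" for t
      using powr_gap_bounds(3)[OF F, of t] that by simp
  qed (use assms in auto)
  then show ?thesis by simp
qed

text \<open>The slope exceeds \<open>F\<close> by an amount between \<open>0\<close> and
  \<open>- ln F * exp (- t)\<close>, and the latter has total integral \<open>- ln F\<close>. The
  profile thus stays within bounded distance of a line of slope \<open>F\<close>, which yields the
  logarithmic growth of the Stein solution.\<close>

lemma stein_profile_minus_linear_bounds:
  assumes "\<tau> \<ge> 0"
  shows "stein_profile F 0 \<le> stein_profile F \<tau> - F * \<tau>"
    "stein_profile F \<tau> - F * \<tau> \<le> stein_profile F 0 - ln F"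
proof -
  have cont: "continuous_on {0..\<tau>} (stein_profile F)"
    using has_real_derivative_stein_profile_within
    by (intro has_field_derivative_imp_has_derivative[THEN has_derivative_continuous_on])
  have "stein_profile F 0 - F * 0 \<le> stein_profile F \<tau> - F * \<tau>"
  proof (rule DERIV_nonneg_imp_increasing_open[OF assms])
    show "\<exists>y. ((\<lambda>t. stein_profile F t - F * t) has_real_derivative y) (at t) \<and> 0 \<le> y"
      if "0 < t" "t < \<tau>" for t
      using that powr_gap_bounds(1)[OF F, of t]
      by (intro exI[of _ "F powr (1 - exp (- t)) - F"])
        (auto intro!: derivative_eq_intros has_real_derivative_stein_profile)
    show "continuous_on {0..\<tau>} (\<lambda>t. stein_profile F t - F * t)"
      by (intro continuous_intros cont)
  qed
  then show "stein_profile F 0 \<le> stein_profile F \<tau> - F * \<tau>" by simp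
  \<comment> \<open>Chosen so that its derivative is the slack in the upper gap bound;
    \<open>1 - exp (- t)\<close> is the antiderivative of \<open>exp (- t)\<close> vanishing at
    \<open>0\<close>.\<close>
  let ?h = "\<lambda>t. F * t - ln F * (1 - exp (- t)) - stein_profile F t"
  have "?h 0 \<le> ?h \<tau>"
  proof (rule DERIV_nonneg_imp_increasing_open[OF assms])
    show "\<exists>y. (?h has_real_derivative y) (at t) \<and> 0 \<le> y"
      if "0 < t" "t < \<tau>" for t
      using that powr_gap_bounds(2)[OF F, of t]
      by (intro exI[of _ "F - ln F * exp (- t) - F powr (1 - exp (- t))"])
        (auto intro!: derivative_eq_intros has_real_derivative_stein_profile)
    show "continuous_on {0..\<tau>} ?h"
      by (intro continuous_intros cont)
  qed
  moreover have "ln F * exp (- \<tau>) \<le> 0"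
    using F by (intro mult_nonpos_nonneg) auto
  ultimately show "stein_profile F \<tau> - F * \<tau> \<le> stein_profile F 0 - ln F"
    by (simp add: algebra_simps)
qed

end

section \<open>The entrance time into the box and the semigroup on its indicator\<close>

lemma joint_cdf_max_stable:
  assumes "Z \<in> borel_measurable M" and L: "max_stable_law \<alpha> \<nu> (distr M borel Z)" and z: "pos_vec z"
  shows "joint_cdf M Z z = exp (- measure (exponent_measure \<alpha> \<nu>) (E0 - {0..z}))"
proof -
  have "{x. x \<le> z} \<in> sets borel"
    using borel_closed[OF closed_eucl_atMost[of z]] by (simp add: atMost_def)
  then have "joint_cdf M Z z = measure (distr M borel Z) {x. x \<le> z}"
    using assms(1) by (subst measure_distr) (auto simp: joint_cdf_def intro!: arg_cong[of _ _ "measure M"])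
  with L z show ?thesis
    by (simp add: max_stable_law_def)
qed

text \<open>For positive \<open>z\<close>, the truncation by \<open>z\<close> keeps every logarithm
  nonnegative, also at vanishing coordinates of \<open>x\<close>, and gives the value
  \<open>0\<close> inside the box.\<close>

definition log_excess :: "real ^ 'd \<Rightarrow> real ^ 'd \<Rightarrow> real" where
  "log_excess z x = Max (range (\<lambda>j. ln (max (x $ j) (z $ j) / z $ j)))"

lemma log_excess_le_iff: "log_excess z x \<le> a \<longleftrightarrow> (\<forall>j. ln (max (x $ j) (z $ j) / z $ j) \<le> a)"
  by (auto simp: log_excess_def)

lemma log_excess_nonneg:
  assumes "pos_vec z"
  shows "0 \<le> log_excess z x"
proof -
  fix j
  have "0 \<le> ln (max (x $ j) (z $ j) / z $ j)"
    using assms by (intro ln_ge_zero) (auto simp: pos_vec_def)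
  also have "\<dots> \<le> log_excess z x"
    using log_excess_le_iff[of z x "log_excess z x"] by simp
  finally show ?thesis .
qed

text \<open>For \<open>t \<ge> 0\<close> one has
  \<open>z $ j \<le> exp (t / \<alpha>) * z $ j\<close>, so replacing \<open>x $ j\<close> by its
  maximum with \<open>z $ j\<close> does not change the coordinate-wise condition. Taking logarithms
  then gives a bound on each term of the maximum.\<close>

lemma scaled_le_iff_log_excess_le:
  assumes z: "pos_vec z" and \<alpha>: "\<alpha> > 0" and t: "t \<ge> 0"
  shows "exp (- t / \<alpha>) *\<^sub>R x \<le> z \<longleftrightarrow> \<alpha> * log_excess z x \<le> t"
proof -
  have "exp (- t / \<alpha>) * x $ j \<le> z $ j \<longleftrightarrow> ln (max (x $ j) (z $ j) / z $ j) \<le> t / \<alpha>" for j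
  proof -
    have zj: "z $ j > 0" using z by (simp add: pos_vec_def)
    have "1 \<le> exp (t / \<alpha>)" using \<alpha> t by simp
    then have "z $ j \<le> exp (t / \<alpha>) * z $ j" using zj by simp
    then have "x $ j \<le> exp (t / \<alpha>) * z $ j \<longleftrightarrow> max (x $ j) (z $ j) / z $ j \<le> exp (t / \<alpha>)"
      using zj by (simp add: divide_le_eq)
    also have "\<dots> \<longleftrightarrow> ln (max (x $ j) (z $ j) / z $ j) \<le> t / \<alpha>"
      using zj by (subst ln_le_cancel_iff[symmetric]) (auto simp: less_max_iff_disj)
    finally show ?thesis
      by (simp add: exp_minus field_simps)
  qed
  moreover have "\<alpha> * log_excess z x \<le> t \<longleftrightarrow> log_excess z x \<le> t / \<alpha>"
    using \<alpha> by (simp add: field_simps)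
  ultimately show ?thesis
    by (simp add: less_eq_vec_def log_excess_le_iff)
qed

text \<open>A maximum lies below \<open>z\<close> iff both arguments do: the deterministic one
  decides the case split, and the random one has probability equal to the c.d.f. at \<open>z\<close>
  divided by \<open>s\<close>, a power of the c.d.f. at \<open>z\<close> by homogeneity. Positive
  \<open>t\<close> makes \<open>s\<close> invertible.\<close>

lemma stein_semigroup_indicator:
  assumes \<alpha>: "\<alpha> > 0" and N: "is_norm N" and \<nu>: "angular_measure N \<nu>"
    and Z: "Z \<in> borel_measurable M" and L: "max_stable_law \<alpha> \<nu> (distr M borel Z)"
    and z: "pos_vec z" and x: "x \<in> orthant" and t: "t > 0"
  shows "stein_semigroup M Z \<alpha> t (indicator {0..z}) x =
    (if \<alpha> * log_excess z x \<le> t then joint_cdf M Z z powr (1 - exp (- t)) else 0)"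
proof -
  define s where "s = (1 - exp (- t)) powr (1 / \<alpha>)"
  have s: "s > 0" using t by (simp add: s_def)
  have "0 \<le> exp (- t / \<alpha>) *\<^sub>R x"
    using x by (auto simp: orthant_def less_eq_vec_def)
  \<comment> \<open>The lower constraint of the box holds for every outcome, whatever the sign of
    \<open>Z \<omega>\<close>, thanks to the nonnegative deterministic part.\<close>
  then have "0 \<le> sup (exp (- t / \<alpha>) *\<^sub>R x) y" for y
    by (rule le_supI1)
  then have ind: "indicator {0..z} (sup (exp (- t / \<alpha>) *\<^sub>R x) (s *\<^sub>R Z \<omega>)) =
      (if \<alpha> * log_excess z x \<le> t then indicator {\<omega>. s *\<^sub>R Z \<omega> \<le> z} \<omega> else 0 :: real)" for \<omega>
    using scaled_le_iff_log_excess_le[OF z \<alpha>, of t x] t by (auto simp: indicator_def)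
  have "s *\<^sub>R y \<le> z \<longleftrightarrow> y \<le> inverse s *\<^sub>R z" for y
    using s by (auto simp: less_eq_vec_def field_simps)
  then have "(\<integral>\<omega>. indicator {\<omega>. s *\<^sub>R Z \<omega> \<le> z} \<omega> \<partial>M) = joint_cdf M Z (inverse s *\<^sub>R z)"
    by (simp add: joint_cdf_def Collect_conj_eq Int_commute)
  also have "\<dots> = exp (- measure (exponent_measure \<alpha> \<nu>) (E0 - {0..inverse s *\<^sub>R z}))"
    using z s by (intro joint_cdf_max_stable Z L) (auto simp: pos_vec_def)
  also have "\<dots> = exp (- ((1 - exp (- t)) * measure (exponent_measure \<alpha> \<nu>) (E0 - {0..z})))"
  proof -
    have "inverse s powr (- \<alpha>) = 1 - exp (- t)"
      using \<alpha> t s by (simp add: powr_minus inverse_powr) (simp add: s_def powr_powr)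
    then show ?thesis
      using s by (subst measure_exponent_measure_scale[OF \<nu> N]) auto
  qed
  also have "\<dots> = joint_cdf M Z z powr (1 - exp (- t))"
    by (simp add: joint_cdf_max_stable[OF Z L z] powr_def)
  finally show ?thesis
    unfolding stein_semigroup_def s_def[symmetric] ind by simp
qed

lemma stein_solution_eq_stein_profile:
  assumes \<alpha>: "\<alpha> > 0" and N: "is_norm N" and \<nu>: "angular_measure N \<nu>"
    and Z: "Z \<in> borel_measurable M" and L: "max_stable_law \<alpha> \<nu> (distr M borel Z)"
    and z: "pos_vec z" and x: "x \<in> orthant"
  shows "stein_solution M Z \<alpha> z x = stein_profile (joint_cdf M Z z) (\<alpha> * log_excess z x)"
proof -
  let ?F = "joint_cdf M Z z" and ?\<tau> = "\<alpha> * log_excess z x"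
  have F: "0 < ?F" "?F \<le> 1"
    by (simp_all add: joint_cdf_max_stable[OF Z L z])
  have \<tau>: "0 \<le> ?\<tau>"
    using \<alpha> log_excess_nonneg[OF z] by simp
  let ?e = "\<lambda>t. (if ?\<tau> \<le> t then ?F powr (1 - exp (- t)) else 0) - ?F"
  \<comment> \<open>The value at \<open>t = 0\<close> is kept as a constant, so that the first
    rewriting is an equality at every \<open>t\<close> and presupposes no measurability of the
    semigroup in \<open>t\<close>. The point is then dropped as a null set.\<close>
  let ?c = "stein_semigroup M Z \<alpha> 0 (indicator {0..z}) x - ?F"
  have "(LINT t:{0..}|lborel. stein_semigroup M Z \<alpha> t (indicator {0..z}) x - ?F) =
      (\<integral>t. (if t = 0 then ?c else indicator {0..} t *\<^sub>R ?e t) \<partial>lborel)"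
    unfolding set_lebesgue_integral_def
    using stein_semigroup_indicator[OF \<alpha> N \<nu> Z L z x]
    by (intro Bochner_Integration.integral_cong) (auto simp: indicator_def)
  also have "\<dots> = (LINT t:{0..}|lborel. ?e t)"
    unfolding set_lebesgue_integral_def
  proof (rule integral_cong_AE)
    show "AE t in lborel. (if t = 0 then ?c else indicator {0..} t *\<^sub>R ?e t) = indicator {0..} t *\<^sub>R ?e t"
      using AE_lborel_singleton[of 0] by eventually_elim auto
  qed measurable
  finally show ?thesis
    using stein_profile_eq[OF F \<tau>] by (simp add: stein_solution_def)
qed

subsection \<open>Smoothness and growth\<close>

lemma ln_max_divide:
  fixes x z :: "real ^ 'd"
  assumes "pos_vec z"
  shows "ln (max (x $ j) (z $ j) / z $ j) = ln (sup x z $ j) - ln (z $ j)"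
proof -
  have "z $ j > 0" "max (x $ j) (z $ j) > 0"
    using assms by (auto simp: pos_vec_def less_max_iff_disj)
  then show ?thesis
    by (simp add: ln_div sup_vec_def sup_max)
qed

text \<open>The excess is the largest coordinate of \<open>ln_vec (sup x z) - ln_vec z\<close>. A
  maximum changes by at most the largest coordinate change, which \<open>norm1\<close>
  dominates.\<close>

lemma log_excess_diff_le:
  assumes z: "pos_vec z"
  shows "\<bar>log_excess z x - log_excess z y\<bar> \<le> norm1 (ln_vec (sup x z) - ln_vec (sup y z))"
proof -
  have le: "log_excess z x \<le> log_excess z y + norm1 (ln_vec (sup x z) - ln_vec (sup y z))" for x y
    unfolding log_excess_le_iff[of z x]
  proof
    fix j
    have "\<bar>(ln_vec (sup x z) - ln_vec (sup y z)) $ j\<bar> \<le> norm1 (ln_vec (sup x z) - ln_vec (sup y z))"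
      unfolding norm1_def by (rule member_le_sum) auto
    moreover have "ln (max (y $ j) (z $ j) / z $ j) \<le> log_excess z y"
      using log_excess_le_iff[of z y "log_excess z y"] by simp
    ultimately show "ln (max (x $ j) (z $ j) / z $ j) \<le>
        log_excess z y + norm1 (ln_vec (sup x z) - ln_vec (sup y z))"
      by (simp add: ln_max_divide[OF z] ln_vec_def)
  qed
  have "norm1 (ln_vec (sup x z) - ln_vec (sup y z)) = norm1 (ln_vec (sup y z) - ln_vec (sup x z))"
    by (simp add: norm1_def abs_minus_commute)
  with le[of x y] le[of y x] show ?thesis by linarith
qed

lemma abs_ln_diff_le:
  fixes a b m :: real
  assumes m: "0 < m" and "m \<le> a" "m \<le> b"
  shows "\<bar>ln a - ln b\<bar> \<le> 1 / m * \<bar>a - b\<bar>"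
proof -
  have "ln a - ln b \<le> 1 / m * \<bar>a - b\<bar>" if "m \<le> a" "m \<le> b" for a b
  proof -
    have "ln a - ln b \<le> (a - b) / b"
      using that m by (intro ln_diff_le) auto
    also have "\<dots> \<le> \<bar>a - b\<bar> / m"
      using that m by (intro frac_le) auto
    finally show ?thesis by simp
  qed
  from this[of a b] this[of b a] assms show ?thesis
    by (simp add: abs_le_iff abs_minus_commute)
qed

lemma min_nonnull_pos_vec:
  assumes "pos_vec z"
  shows "0 < min_nonnull z" "min_nonnull z \<le> z $ j"
proof -
  have "min_nonnull z = Min (range (\<lambda>j. z $ j))"
    using assms unfolding min_nonnull_def pos_vec_def
    by (intro arg_cong[of _ _ Min] image_cong) (auto simp: less_le)
  with assms show "0 < min_nonnull z" "min_nonnull z \<le> z $ j"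
    by (auto simp: pos_vec_def)
qed

lemma norm1_ln_vec_sup_diff_le:
  assumes z: "pos_vec z"
  shows "norm1 (ln_vec (sup x z) - ln_vec (sup y z)) \<le> 1 / min_nonnull z * norm1 (sup x z - sup y z)"
  unfolding norm1_def sum_distrib_left
proof (rule sum_mono)
  fix j
  show "\<bar>(ln_vec (sup x z) - ln_vec (sup y z)) $ j\<bar> \<le> 1 / min_nonnull z * \<bar>(sup x z - sup y z) $ j\<bar>"
    using abs_ln_diff_le[of "min_nonnull z" "sup x z $ j" "sup y z $ j"] min_nonnull_pos_vec(1)[OF z] min_nonnull_pos_vec(2)[OF z, of j]
    by (simp add: ln_vec_def sup_vec_def sup_max le_max_iff_disj)
qed

lemma norm1_sup_diff_le: "norm1 (sup x z - sup y z) \<le> norm1 (x - y)"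
  unfolding norm1_def by (rule sum_mono) (auto simp: sup_vec_def sup_max max_def)

section \<open>Dominant coordinates and the open pieces of the smooth region\<close>

lemma log_excess_dominant:
  assumes z: "pos_vec z" and dom: "\<And>i. x $ i / z $ i \<le> x $ j / z $ j" and "z $ j \<le> x $ j"
  shows "log_excess z x = ln (x $ j / z $ j)"
proof (rule antisym)
  have zpos: "z $ i > 0" for i using z by (simp add: pos_vec_def)
  have "1 \<le> x $ j / z $ j" using zpos[of j] assms(3) by simp
  show "log_excess z x \<le> ln (x $ j / z $ j)"
    unfolding log_excess_le_iff
  proof
    fix i
    \<comment> \<open>The truncated ratio is either the \<open>i\<close>-th ratio or
      \<open>1\<close>, and the \<open>j\<close>-th ratio bounds both.\<close>
    have "max (x $ i) (z $ i) / z $ i \<le> x $ j / z $ j"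
      using dom[of i] \<open>1 \<le> x $ j / z $ j\<close> zpos[of i] by (auto simp: max_def)
    then show "ln (max (x $ i) (z $ i) / z $ i) \<le> ln (x $ j / z $ j)"
      using zpos[of i] by (intro ln_mono) (auto simp: less_max_iff_disj)
  qed
  have "ln (max (x $ j) (z $ j) / z $ j) \<le> log_excess z x"
    using log_excess_le_iff[of z x "log_excess z x"] by simp
  then show "ln (x $ j / z $ j) \<le> log_excess z x"
    using assms(3) by (simp add: max_def)
qed

lemma log_excess_eq_0:
  assumes z: "pos_vec z" and "x \<le> z"
  shows "log_excess z x = 0"
proof (rule antisym[OF _ log_excess_nonneg[OF z]])
  have "max (x $ j) (z $ j) = z $ j" "z $ j \<noteq> 0" for j
    using assms by (auto simp: less_eq_vec_def pos_vec_def less_le max_def intro: antisym)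
  then show "log_excess z x \<le> 0"
    by (simp add: log_excess_le_iff)
qed

text \<open>The strict inequalities make this set open, so the one-coordinate formula for the excess
  holds near each of its points relative to the orthant and can be differentiated.\<close>

definition dominant_region :: "real ^ 'd \<Rightarrow> 'd \<Rightarrow> (real ^ 'd) set" where
  "dominant_region z j = {x. z $ j < x $ j \<and> (\<forall>i. i \<noteq> j \<longrightarrow> x $ i / z $ i < x $ j / z $ j)}"

lemma open_dominant_region: "open (dominant_region z j)"
proof -
  have "open {x. i \<noteq> j \<longrightarrow> x $ i / z $ i < x $ j / z $ j}" for i
    by (cases "i = j") (auto simp: divide_inverse intro!: open_Collect_less continuous_intros)
  then have "open (\<Inter>i. {x. i \<noteq> j \<longrightarrow> x $ i / z $ i < x $ j / z $ j})"
    by (intro open_INT) auto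
  then show ?thesis
    unfolding dominant_region_def Collect_all_eq[symmetric]
    by (intro open_Collect_conj open_Collect_less continuous_intros)
qed

lemma dominant_region_disjoint:
  assumes "x \<in> dominant_region z i" "x \<in> dominant_region z j"
  shows "i = j"
  using assms unfolding dominant_region_def by (metis (mono_tags, lifting) mem_Collect_eq order_less_asym)

lemma open_less_region: "open {x :: real ^ 'd. \<forall>j. x $ j < z $ j}"
proof -
  have "open (\<Inter>j. {x :: real ^ 'd. x $ j < z $ j})"
    by (intro open_INT ballI open_Collect_less continuous_intros) auto
  then show ?thesis by (simp add: Collect_all_eq)
qed

text \<open>The largest ratio is above or below \<open>1\<close>, equality being excluded by
  \<open>ne\<close>. Above \<open>1\<close>, uniqueness makes the dominance strict; below
  \<open>1\<close>, every ratio is below \<open>1\<close>.\<close>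

lemma smooth_region_cases:
  assumes z: "pos_vec z" and dom: "unique_dominant z x j" and ne: "x $ j \<noteq> z $ j"
  shows "x \<in> dominant_region z j \<or> (\<forall>i. x $ i < z $ i)"
proof -
  have zpos: "z $ i > 0" for i using z by (simp add: pos_vec_def)
  have le: "x $ i / z $ i \<le> x $ j / z $ j" for i
    using dom unfolding unique_dominant_def by blast
  show ?thesis
  proof (cases "z $ j < x $ j")
    case True
    have "x $ i / z $ i < x $ j / z $ j" if "i \<noteq> j" for i
    proof -
      have "x $ i / z $ i \<noteq> x $ j / z $ j"
        using dom that le unfolding unique_dominant_def by metis
      with le[of i] show ?thesis by simp
    qed
    with True show ?thesis by (simp add: dominant_region_def)
  next
    case False
    then have "x $ j / z $ j < 1" using ne zpos[of j] by simp
    have "x $ i < z $ i" for i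
      using order_le_less_trans[OF le[of i] \<open>x $ j / z $ j < 1\<close>] zpos[of i] by simp
    then show ?thesis by simp
  qed
qed

section \<open>Partial derivatives relative to the orthant\<close>

lemma coord_upd_nth [simp]: "coord_upd x j s $ k = (if k = j then s else x $ k)"
  by (simp add: coord_upd_def)

lemma coord_upd_same [simp]: "coord_upd x j (x $ j) = x"
  by (simp add: vec_eq_iff)

lemma coord_upd_orthant: "x \<in> orthant \<Longrightarrow> 0 \<le> s \<Longrightarrow> coord_upd x j s \<in> orthant"
  by (simp add: orthant_def)

text \<open>Chain rule along the coordinate line through \<open>x\<close>, which stays in the
  orthant for nonnegative parameters, so the derivative within the orthant suffices.\<close>

lemma has_derivative_imp_has_partial_derivative:
  assumes f: "(f has_derivative f') (at x within orthant)" and x: "x \<in> orthant"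
  shows "has_partial_derivative f j x (f' (axis j 1))"
proof -
  have eq: "coord_upd x j s = x + (s - x $ j) *\<^sub>R axis j 1" for s
    by (auto simp: vec_eq_iff axis_def)
  have "(coord_upd x j has_derivative (\<lambda>h. h *\<^sub>R axis j 1)) (at (x $ j) within {0..})"
    unfolding eq[abs_def] by (auto intro!: derivative_eq_intros)
  moreover have "(f has_derivative f') (at (coord_upd x j (x $ j)) within coord_upd x j ` {0..})"
    using f coord_upd_orthant[OF x] by (auto intro!: has_derivative_subset[of f f' x orthant])
  ultimately have "((\<lambda>s. f (coord_upd x j s)) has_derivative (\<lambda>h. f' (h *\<^sub>R axis j 1))) (at (x $ j) within {0..})"
    by (rule has_derivative_in_compose)
  moreover have "f' (h *\<^sub>R axis j 1) = f' (axis j 1) * h" for h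
    using linear_scale[OF has_derivative_linear[OF f]] by simp
  ultimately show ?thesis
    by (simp add: has_partial_derivative_def has_field_derivative_def)
qed

text \<open>Difference quotients are controlled by the logarithmic Lipschitz bound alone, without a
  formula for the derivative. The estimate therefore also covers points with several dominant
  coordinates, whenever the partial derivative exists there.\<close>

lemma has_partial_derivative_bound:
  fixes g :: "real ^ 'd \<Rightarrow> real"
  assumes lip: "\<And>x y. x \<in> orthant \<Longrightarrow> y \<in> orthant \<Longrightarrow>
      \<bar>g x - g y\<bar> \<le> \<alpha> * norm1 (ln_vec (sup x z) - ln_vec (sup y z))"
    and z: "pos_vec z" and x: "x \<in> orthant" and D: "has_partial_derivative g j x D"
  shows "\<bar>D\<bar> \<le> \<alpha> / x $ j * (if x $ j > z $ j then 1 else 0)"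
proof -
  let ?f = "\<lambda>s. g (coord_upd x j s)"
  have zj: "z $ j > 0" and xj: "x $ j \<ge> 0"
    using z x by (auto simp: pos_vec_def orthant_def)
  have f: "(?f has_real_derivative D) (at (x $ j) within {0..})"
    using D by (simp add: has_partial_derivative_def)
  have bound: "\<bar>?f s - ?f (x $ j)\<bar> \<le> \<alpha> * \<bar>ln (max s (z $ j)) - ln (max (x $ j) (z $ j))\<bar>"
    if "s \<ge> 0" for s
  proof -
    let ?v = "ln_vec (sup (coord_upd x j s) z) - ln_vec (sup x z)"
    have "norm1 ?v = (\<Sum>k\<in>UNIV. if k = j then \<bar>ln (max s (z $ j)) - ln (max (x $ j) (z $ j))\<bar> else 0)"
      unfolding norm1_def by (intro sum.cong) (auto simp: ln_vec_def sup_vec_def sup_max)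
    then show ?thesis
      using lip[OF coord_upd_orthant[OF x that] x, of j] by simp
  qed
  show ?thesis
  proof (cases "x $ j > z $ j")
    case True
    have "at (x $ j) within {0..} = at (x $ j)"
      using True zj by (intro at_within_interior) auto
    with f have "((\<lambda>s. \<bar>(?f s - ?f (x $ j)) / (s - x $ j)\<bar>) \<longlongrightarrow> \<bar>D\<bar>) (at (x $ j))"
      by (intro tendsto_rabs) (simp add: has_field_derivative_iff)
    moreover have "(ln has_real_derivative 1 / x $ j) (at (x $ j))"
      using True zj by (auto intro!: derivative_eq_intros)
    then have "((\<lambda>s. \<alpha> * \<bar>(ln s - ln (x $ j)) / (s - x $ j)\<bar>) \<longlongrightarrow> \<alpha> * \<bar>1 / x $ j\<bar>) (at (x $ j))"
      unfolding has_field_derivative_iff by (intro tendsto_mult_left tendsto_rabs)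
    moreover have "\<forall>\<^sub>F s in at (x $ j). s > z $ j"
      using True by (intro order_tendstoD[OF tendsto_ident_at])
    \<comment> \<open>Near \<open>x $ j\<close> the parameter exceeds \<open>z $ j\<close>, so both
      truncations by \<open>z\<close> disappear and the bound is a difference quotient of
      \<open>ln\<close>.\<close>
    then have "\<forall>\<^sub>F s in at (x $ j). \<bar>(?f s - ?f (x $ j)) / (s - x $ j)\<bar> \<le> \<alpha> * \<bar>(ln s - ln (x $ j)) / (s - x $ j)\<bar>"
    proof eventually_elim
      case (elim s)
      then have "\<bar>?f s - ?f (x $ j)\<bar> \<le> \<alpha> * \<bar>ln s - ln (x $ j)\<bar>"
        using bound[of s] True zj by (simp add: max_def)
      then show ?case
        unfolding abs_divide times_divide_eq_right by (intro divide_right_mono) auto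
    qed
    ultimately have "\<bar>D\<bar> \<le> \<alpha> * \<bar>1 / x $ j\<bar>"
      by (intro tendsto_le[OF trivial_limit_at])
    then show ?thesis using True xj by simp
  next
    \<comment> \<open>Along the segment \<open>{0..z $ j}\<close> the truncated coordinate does not
      move, so the function is constant there. The segment is nondegenerate and contains
      \<open>x $ j\<close>, possibly as its right endpoint, so uniqueness of the derivative within
      it forces \<open>D = 0\<close>.\<close>
    case False
    have const: "?f s = ?f (x $ j)" if "s \<in> {0..z $ j}" for s
      using bound[of s] that False by (simp add: max_def split: if_splits)
    have "(?f has_real_derivative D) (at (x $ j) within {0..z $ j})"
      by (rule DERIV_subset[OF f]) auto
    moreover have "(?f has_real_derivative 0) (at (x $ j) within {0..z $ j})"
      by (rule has_field_derivative_transform_within[of "\<lambda>_. ?f (x $ j)" _ _ _ 1])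
        (use const False xj in auto)
    moreover have "at (x $ j) within {0..z $ j} \<noteq> bot"
      using zj False xj by (simp add: trivial_limit_within islimpt_Icc)
    ultimately have "D = 0"
      by (metis has_field_derivative_unique)
    then show ?thesis using False by simp
  qed
qed

section \<open>Derivatives of the Stein solution and their continuity\<close>

lemma has_derivative_transform_within_open_Int:
  assumes "(f has_derivative f') (at x within t)" and "open s" "x \<in> s" "x \<in> t"
    and "\<And>y. y \<in> s \<Longrightarrow> y \<in> t \<Longrightarrow> f y = g y"
  shows "(g has_derivative f') (at x within t)"
  using assms
  by (intro has_derivative_transform_eventually[OF assms(1)]) (auto simp: eventually_at_topological)

text \<open>Where \<open>j\<close> strictly dominates outside the box, \<open>g\<close> is locally
  the profile at \<open>\<alpha> * ln (x $ j / z $ j)\<close>, and the chain rule gives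
  \<open>c j x\<close>. Where all coordinates lie below those of \<open>z\<close>, \<open>g\<close>
  is locally constant. These open pieces cover the smooth region.\<close>

lemma stein_profile_log_excess_derivatives:
  fixes z :: "real ^ 'd"
  assumes \<alpha>: "\<alpha> > 0" and F: "0 < F" "F \<le> 1" and z: "pos_vec z"
    and g: "\<And>x. x \<in> orthant \<Longrightarrow> g x = stein_profile F (\<alpha> * log_excess z x)"
  defines "c \<equiv> \<lambda>j x. \<alpha> / x $ j * F powr (1 - (z $ j / x $ j) powr \<alpha>)"
  shows has_derivative_dominant_region:
      "\<And>x j. x \<in> orthant \<Longrightarrow> x \<in> dominant_region z j \<Longrightarrow>
        (g has_derivative (\<lambda>h. c j x * h $ j)) (at x within orthant)"
    and has_derivative_less_region:
      "\<And>x. x \<in> orthant \<Longrightarrow> (\<forall>j. x $ j < z $ j) \<Longrightarrow> (g has_derivative (\<lambda>h. 0)) (at x within orthant)"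
    and continuously_differentiable_on_smooth_region: "continuously_differentiable_on g (smooth_region z)"
proof -
  have zpos: "z $ j > 0" for j using z by (simp add: pos_vec_def)
  show dominant: "(g has_derivative (\<lambda>h. c j x * h $ j)) (at x within orthant)"
    if x: "x \<in> orthant" and xj: "x \<in> dominant_region z j" for x j
  proof (rule has_derivative_transform_within_open_Int[OF _ open_dominant_region[of z j] xj])
    let ?p = "\<lambda>s. stein_profile F (\<alpha> * ln (s / z $ j))"
    have lt: "z $ j < x $ j" using xj by (simp add: dominant_region_def)
    have xpos: "x $ j > 0" using lt zpos[of j] by simp
    have gt1: "\<alpha> * ln (x $ j / z $ j) > 0"
      using \<alpha> lt zpos[of j] by simp
    \<comment> \<open>Evaluating the slope of the profile at the entrance time turns
      \<open>exp (- t)\<close> into the power in the stated formula.\<close>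
    have "exp (- (\<alpha> * ln (x $ j / z $ j))) = (z $ j / x $ j) powr \<alpha>"
      using xpos zpos[of j] by (simp add: powr_def ln_div algebra_simps)
    then have "(stein_profile F has_real_derivative F powr (1 - (z $ j / x $ j) powr \<alpha>))
        (at (\<alpha> * ln (x $ j / z $ j)))"
      using has_real_derivative_stein_profile[OF F gt1] by simp
    moreover have "((\<lambda>s. \<alpha> * ln (s / z $ j)) has_real_derivative \<alpha> / x $ j) (at (x $ j))"
      using xpos zpos[of j] by (auto intro!: derivative_eq_intros simp: field_simps)
    ultimately have "(?p has_real_derivative F powr (1 - (z $ j / x $ j) powr \<alpha>) * (\<alpha> / x $ j)) (at (x $ j))"
      by (rule DERIV_chain2)
    then have "(?p has_real_derivative c j x) (at (x $ j))"
      unfolding c_def by (subst mult.commute)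
    then have "(?p has_derivative (\<lambda>h. c j x * h)) (at (x $ j))"
      by (simp add: has_field_derivative_def)
    moreover have "((\<lambda>x. x $ j) has_derivative (\<lambda>h. h $ j)) (at x within orthant)"
      by (rule bounded_linear_imp_has_derivative[OF bounded_linear_vec_nth])
    ultimately show "((\<lambda>x. ?p (x $ j)) has_derivative (\<lambda>h. c j x * h $ j)) (at x within orthant)"
      by (rule has_derivative_compose[rotated])
  next
    fix y assume y: "y \<in> dominant_region z j"  and "y \<in> orthant"
    have "y $ i / z $ i \<le> y $ j / z $ j" for i
      using y by (cases "i = j") (auto simp: dominant_region_def intro: less_imp_le)
    then have "log_excess z y = ln (y $ j / z $ j)"
      using y by (intro log_excess_dominant[OF z]) (auto simp: dominant_region_def)
    with g[OF \<open>y \<in> orthant\<close>] show "stein_profile F (\<alpha> * ln (y $ j / z $ j)) = g y" by simp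
  qed (use x in auto)
  show less: "(g has_derivative (\<lambda>h. 0)) (at x within orthant)"
    if x: "x \<in> orthant" and lt: "\<forall>j. x $ j < z $ j" for x
  proof (rule has_derivative_transform_within_open_Int[of "\<lambda>_. stein_profile F 0" _ _ _ "{x. \<forall>j. x $ j < z $ j}"])
    fix y assume "y \<in> {x. \<forall>j. x $ j < z $ j}" "y \<in> orthant"
    moreover from this have "log_excess z y = 0"
      by (intro log_excess_eq_0[OF z]) (auto simp: less_eq_vec_def less_imp_le)
    ultimately show "stein_profile F 0 = g y" using g by simp
  next
    show "x \<in> {x. \<forall>j. x $ j < z $ j}" using lt by simp
  qed (rule has_derivative_const open_less_region x)+
  show "continuously_differentiable_on g (smooth_region z)"
    unfolding continuously_differentiable_on_def
  proof (intro exI conjI ballI)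
    define \<pi> :: "'d \<Rightarrow> (real ^ 'd) \<Rightarrow>\<^sub>L real" where "\<pi> j = Blinfun (\<lambda>h. h $ j)" for j
    have \<pi>: "blinfun_apply (\<pi> j) h = h $ j" for j h
      unfolding \<pi>_def by (subst bounded_linear_Blinfun_apply) (auto intro: bounded_linear_vec_nth)
    \<comment> \<open>The dominant regions are pairwise disjoint, so at most one summand is nonzero;
      the sum defines the derivative globally without choosing a dominant index.\<close>
    define f' where "f' x = (\<Sum>j\<in>UNIV. (if x \<in> dominant_region z j then c j x else 0) *\<^sub>R \<pi> j)" for x
    have f'_dominant: "f' x = c j x *\<^sub>R \<pi> j" if "x \<in> dominant_region z j" for x j
    proof -
      have "x \<notin> dominant_region z i" if "i \<noteq> j" for i
        using dominant_region_disjoint[OF \<open>x \<in> dominant_region z j\<close>] that by blast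
      then have "f' x = (\<Sum>i\<in>UNIV. if i = j then c j x *\<^sub>R \<pi> j else 0)"
        unfolding f'_def using that by (intro sum.cong) auto
      then show ?thesis by simp
    qed
    have f'_less: "f' x = 0" if "\<forall>j. x $ j < z $ j" for x
    proof -
      have "x \<notin> dominant_region z j" for j
        using that by (auto simp: dominant_region_def not_less less_imp_le)
      then show ?thesis by (simp add: f'_def)
    qed
    show "(g has_derivative blinfun_apply (f' x)) (at x within orthant)" if sm: "x \<in> smooth_region z" for x
    proof -
      obtain j where x: "x \<in> orthant" and "unique_dominant z x j" "x $ j \<noteq> z $ j"
        using sm by (auto simp: smooth_region_def)
      from smooth_region_cases[OF z this(2,3)] show ?thesis
      proof
        assume *: "x \<in> dominant_region z j"
        show ?thesis
          using dominant[OF x *] unfolding f'_dominant[OF *]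
          by (rule has_derivative_eq_rhs) (simp add: fun_eq_iff blinfun.scaleR_left \<pi>)
      next
        assume *: "\<forall>i. x $ i < z $ i"
        show ?thesis
          using less[OF x *] unfolding f'_less[OF *] by (simp add: zero_blinfun.rep_eq)
      qed
    qed
    \<comment> \<open>Continuity is proved on a union of open sets, where it can be checked piece by
      piece, and then restricted to the smooth region.\<close>
    have "continuous_on ({x. \<forall>j. x $ j < z $ j} \<union> (\<Union>j. dominant_region z j)) f'"
    proof (intro continuous_on_open_Un continuous_on_open_UN open_UN ballI open_less_region open_dominant_region)
      show "continuous_on {x. \<forall>j. x $ j < z $ j} f'"
        by (rule continuous_on_eq[OF continuous_on_const[of _ 0]]) (simp add: f'_less)
      show "continuous_on (dominant_region z j) f'" for j
      proof (rule continuous_on_eq)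
        have "x $ j > 0" if "x \<in> dominant_region z j" for x
          using that zpos[of j] by (simp add: dominant_region_def)
        then have "\<forall>x \<in> dominant_region z j. x $ j \<noteq> 0" "\<forall>x \<in> dominant_region z j. z $ j / x $ j \<noteq> 0"
          using zpos[of j] by force+
        then show "continuous_on (dominant_region z j) (\<lambda>x. c j x *\<^sub>R \<pi> j)"
          unfolding c_def using F by (intro continuous_intros) auto
      qed (simp add: f'_dominant)
    qed
    moreover have "smooth_region z \<subseteq> {x. \<forall>j. x $ j < z $ j} \<union> (\<Union>j. dominant_region z j)"
      using smooth_region_cases[OF z] by (fastforce simp: smooth_region_def)
    ultimately show "continuous_on (smooth_region z) f'"
      by (rule continuous_on_subset)
  qed
qed

section \<open>Logarithmic growth along a coordinate\<close>

lemma stein_profile_log_excess_asymp_equiv: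
  fixes z :: "real ^ 'd"
  assumes \<alpha>: "\<alpha> > 0" and F: "0 < F" "F \<le> 1" and z: "pos_vec z"
    and g: "\<And>x. x \<in> orthant \<Longrightarrow> g x = stein_profile F (\<alpha> * log_excess z x)" and x: "x \<in> orthant"
  shows "(\<lambda>s. g (coord_upd x j s)) \<sim>[at_top] (\<lambda>s. \<alpha> * F * ln s)"
proof -
  have zpos: "z $ i > 0" for i using z by (simp add: pos_vec_def)
  \<comment> \<open>The first two terms bound the distance of the profile from its line, from below
    and above; the third is the shift caused by
    \<open>ln (s / z $ j) = ln s - ln (z $ j)\<close>.\<close>
  let ?C = "\<bar>stein_profile F 0\<bar> + \<bar>stein_profile F 0 - ln F\<bar> + \<bar>F * \<alpha> * ln (z $ j)\<bar>"
  \<comment> \<open>Beyond these thresholds coordinate \<open>j\<close> dominates and the point has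
    left the interior of the box, so the excess depends on \<open>s\<close> only.\<close>
  have "\<forall>\<^sub>F s in at_top. \<forall>i. z $ j * (x $ i / z $ i) \<le> s"
    by (intro eventually_all_finite eventually_ge_at_top)
  moreover have "\<forall>\<^sub>F s in at_top. z $ j \<le> s" by (rule eventually_ge_at_top)
  ultimately have "\<forall>\<^sub>F s in at_top. \<bar>g (coord_upd x j s) - \<alpha> * F * ln s\<bar> \<le> ?C"
  proof eventually_elim
    case (elim s)
    let ?\<tau> = "\<alpha> * ln (s / z $ j)"
    have s: "s > 0" using elim(2) zpos[of j] by simp
    have "log_excess z (coord_upd x j s) = ln (coord_upd x j s $ j / z $ j)"
      using elim zpos by (intro log_excess_dominant[OF z]) (auto simp: field_simps)
    then have "g (coord_upd x j s) = stein_profile F ?\<tau>"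
      using g[OF coord_upd_orthant[OF x]] s by simp
    moreover have "?\<tau> \<ge> 0"
      using \<alpha> elim(2) zpos[of j] by simp
    note stein_profile_minus_linear_bounds[OF F this]
    moreover have "F * ?\<tau> = \<alpha> * F * ln s - F * \<alpha> * ln (z $ j)"
      using s zpos[of j] by (simp add: ln_div algebra_simps)
    ultimately show ?case by linarith
  qed
  \<comment> \<open>Equivalence means that the difference is negligible: it is bounded, while
    \<open>\<alpha> * F * ln s\<close> diverges because \<open>\<alpha> * F\<close> is
    positive.\<close>
  then have "(\<lambda>s. g (coord_upd x j s) - \<alpha> * F * ln s) \<in> O(\<lambda>_. 1)"
    by (intro bigoI[of _ ?C]) simp
  moreover have "(\<lambda>_. 1) \<in> o(\<lambda>s. \<alpha> * F * ln s)"
  proof (rule smalloI_tendsto)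
    have lim: "filterlim (\<lambda>s. \<alpha> * F * ln s) at_top at_top"
      using \<alpha> F by (intro filterlim_tendsto_pos_mult_at_top[OF tendsto_const _ ln_at_top]) simp
    then show "((\<lambda>s. 1 / (\<alpha> * F * ln s)) \<longlongrightarrow> 0) at_top"
      by (intro tendsto_divide_0[OF tendsto_const] filterlim_at_top_imp_at_infinity)
    show "\<forall>\<^sub>F s in at_top. \<alpha> * F * ln s \<noteq> 0"
      using eventually_gt_at_top[of 1] by eventually_elim (use \<alpha> F in auto)
  qed
  ultimately show ?thesis
    unfolding asymp_equiv_altdef by (rule landau_o.big_small_trans)
qed

section \<open>Derivation of the seven claims from the profile representation of
  \<open>g\<close>\<close>

theorem theorem7:
  fixes \<alpha> :: real
    and N :: "real ^ 'd \<Rightarrow> real"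
    and \<nu> :: "(real ^ 'd) measure"
    and M :: "'w measure"
    and Z :: "'w \<Rightarrow> real ^ 'd"
    and z :: "real ^ 'd"
    and F :: real
    and g :: "real ^ 'd \<Rightarrow> real"
  assumes "\<alpha> > 0"
    and "is_norm N" and "pos_sphere N \<subseteq> {0..1}"
    and "angular_measure N \<nu>"
    and "prob_space M" and "Z \<in> borel_measurable M"
    and "max_stable_law \<alpha> \<nu> (distr M borel Z)"
    and "pos_vec z"
  defines "F \<equiv> joint_cdf M Z z"
    and "g \<equiv> stein_solution M Z \<alpha> z"
  shows
    "(\<forall>x\<in>{0..z}. g x = - F * (LINT t:{0..}|lborel. F powr (- exp (- t)) - 1)) \<and>
     (\<forall>x\<in>orthant. \<forall>j. (\<lambda>s. g (coord_upd x j s)) \<sim>[at_top] (\<lambda>s. \<alpha> * F * ln s)) \<and>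
     continuously_differentiable_on g (smooth_region z) \<and>
     (\<forall>x\<in>smooth_region z. \<forall>j0. unique_dominant z x j0 \<longrightarrow>
        (\<forall>j. has_partial_derivative g j x
               (if j = j0 \<and> z $ j < x $ j
                then \<alpha> / x $ j * F powr (1 - (z $ j / x $ j) powr \<alpha>)
                else 0))) \<and>
     (\<forall>x\<in>orthant. \<forall>j D. has_partial_derivative g j x D \<longrightarrow>
        \<bar>D\<bar> \<le> \<alpha> / x $ j * (if x $ j > z $ j then 1 else 0)) \<and>
     (\<forall>x\<in>orthant. \<forall>y\<in>orthant.
        inverse \<alpha> * \<bar>g x - g y\<bar> \<le>
          min (norm1 (ln_vec (sup x z) - ln_vec (sup y z)))
              (1 / min_nonnull z * norm1 (sup x z - sup y z))) \<and>
     lipschitz1_on (\<alpha> / min_nonnull z) orthant g"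
proof (intro conjI ballI allI impI)
  note \<alpha> = \<open>\<alpha> > 0\<close> and z = \<open>pos_vec z\<close>
  have F: "0 < F" "F \<le> 1"
    by (simp_all add: F_def joint_cdf_max_stable[OF assms(6-8)])
  have g: "g x = stein_profile F (\<alpha> * log_excess z x)" if "x \<in> orthant" for x
    unfolding g_def F_def
    using stein_solution_eq_stein_profile[OF assms(1,2,4,6-8) that] .
  \<comment> \<open>The common estimate behind the derivative bound, the logarithmic bound and the
    Lipschitz constant: the 1-Lipschitz profile composed with the excess.\<close>
  have lip: "\<bar>g x - g y\<bar> \<le> \<alpha> * norm1 (ln_vec (sup x z) - ln_vec (sup y z))"
    if "x \<in> orthant" "y \<in> orthant" for x y
  proof -
    have "\<bar>g x - g y\<bar> \<le> \<bar>\<alpha> * log_excess z x - \<alpha> * log_excess z y\<bar>"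
      unfolding g[OF that(1)] g[OF that(2)]
      using \<alpha> log_excess_nonneg[OF z] by (intro stein_profile_lipschitz[OF F]) auto
    also have "\<dots> = \<alpha> * \<bar>log_excess z x - log_excess z y\<bar>"
      using \<alpha> by (simp add: abs_mult flip: right_diff_distrib)
    also have "\<dots> \<le> \<alpha> * norm1 (ln_vec (sup x z) - ln_vec (sup y z))"
      using \<alpha> log_excess_diff_le[OF z] by (intro mult_left_mono) auto
    finally show ?thesis .
  qed
  show "g x = - F * (LINT t:{0..}|lborel. F powr (- exp (- t)) - 1)" if "x \<in> {0..z}" for x
  proof -
    have "x \<in> orthant" "x \<le> z"
      using that by (auto simp: orthant_def less_eq_vec_def)
    then show ?thesis
      using g log_excess_eq_0[OF z] stein_profile_0[OF F] by simp
  qed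
  show "(\<lambda>s. g (coord_upd x j s)) \<sim>[at_top] (\<lambda>s. \<alpha> * F * ln s)" if "x \<in> orthant" for x j
    using stein_profile_log_excess_asymp_equiv[OF \<alpha> F z g that] .
  show "continuously_differentiable_on g (smooth_region z)"
    using continuously_differentiable_on_smooth_region[OF \<alpha> F z g] .
  show "has_partial_derivative g j x
      (if j = j0 \<and> z $ j < x $ j then \<alpha> / x $ j * F powr (1 - (z $ j / x $ j) powr \<alpha>) else 0)"
    if "x \<in> smooth_region z" and dom: "unique_dominant z x j0" for x j0 j
  proof -
    \<comment> \<open>A dominant index is determined by \<open>x\<close>, so the witness in
      \<open>smooth_region\<close> is \<open>j0\<close> itself.\<close>
    have x: "x \<in> orthant" and ne: "x $ j0 \<noteq> z $ j0"
      using that by (auto simp: smooth_region_def unique_dominant_def)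
    from smooth_region_cases[OF z dom ne] show ?thesis
    proof
      assume *: "x \<in> dominant_region z j0"
      then have "z $ j0 < x $ j0" by (simp add: dominant_region_def)
      with has_derivative_imp_has_partial_derivative
          [OF has_derivative_dominant_region[OF \<alpha> F z g x *] x, of j]
      show ?thesis by (cases "j = j0") (auto simp: axis_def)
    next
      \<comment> \<open>Below \<open>z\<close> in every coordinate the condition
        \<open>z $ j < x $ j\<close> fails, so the claimed value is \<open>0\<close>, matching the
        locally constant \<open>g\<close>.\<close>
      assume *: "\<forall>i. x $ i < z $ i"
      then have "\<not> z $ j < x $ j" by (simp add: not_less less_imp_le)
      with has_derivative_imp_has_partial_derivative
          [OF has_derivative_less_region[OF \<alpha> F z g x *] x, of j]
      show ?thesis by auto
    qed
  qed
  show "\<bar>D\<bar> \<le> \<alpha> / x $ j * (if x $ j > z $ j then 1 else 0)"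
    if "x \<in> orthant" "has_partial_derivative g j x D" for x j D
    using has_partial_derivative_bound[OF lip z that] .
  show "inverse \<alpha> * \<bar>g x - g y\<bar> \<le>
      min (norm1 (ln_vec (sup x z) - ln_vec (sup y z))) (1 / min_nonnull z * norm1 (sup x z - sup y z))"
    if "x \<in> orthant" "y \<in> orthant" for x y
  proof -
    have "inverse \<alpha> * \<bar>g x - g y\<bar> \<le> norm1 (ln_vec (sup x z) - ln_vec (sup y z))"
      using lip[OF that] \<alpha> by (simp add: field_simps)
    with norm1_ln_vec_sup_diff_le[OF z, of x y] show ?thesis by simp
  qed
  show "lipschitz1_on (\<alpha> / min_nonnull z) orthant g"
    unfolding lipschitz1_on_def
  proof (intro conjI ballI)
    have m: "min_nonnull z > 0" using min_nonnull_pos_vec(1)[OF z] .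
    show "0 \<le> \<alpha> / min_nonnull z" using \<alpha> m by simp
    fix x y :: "real ^ 'd" assume xy: "x \<in> orthant" "y \<in> orthant"
    note lip[OF xy]
    also have "\<alpha> * norm1 (ln_vec (sup x z) - ln_vec (sup y z)) \<le>
        \<alpha> * (1 / min_nonnull z * norm1 (x - y))"
      using \<alpha> m by (intro mult_left_mono order_trans[OF norm1_ln_vec_sup_diff_le[OF z]] norm1_sup_diff_le) auto
    finally show "\<bar>g x - g y\<bar> \<le> \<alpha> / min_nonnull z * norm1 (x - y)" by simp
  qed
qed

end
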